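(* Let $K$ be an $\mathcal O$-operator on a Leibniz algebra $(\mathfrak g,[\ ,\ ])$ with respect to a representation $(V,\rho^L,\rho^R)$, and let $\Theta:\mathfrak g\to V$ be a solution of the strong Maurer-Cartan equation on the twilled Leibniz algebra $(\mathfrak g\bowtie V_K,\{\ ,\ \}_K)$. Put $N=K\Theta\in\mathfrak{gl}(\mathfrak g)$ and $S=\Theta K\in\mathfrak{gl}(V)$. Then: (i) $(K,S,N)$ is a dual $\mathcal O$N-structure on $(\mathfrak g,[\ ,\ ])$ with respect to the representation $(V,\rho^L,\rho^R)$. (ii) $(\Theta,N,S)$ is a dual $\mathcal O$N-structure on $(V_K,[\ ,\ ]^K)$ associated to the representation $(\mathfrak g,\varrho_K^L,\varrho_K^R)$ (here $N$ acts on the representation space $\mathfrak g$ and $S$ acts on the Leibniz algebra $V_K$).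
   Context: $k$ is a field of characteristic $0$; all vector spaces are finite dimensional over $k$. A (left) Leibniz algebra $(\mathfrak g,[\ ,\ ])$ is a vector space with a bilinear bracket satisfying $[x,[y,z]]=[[x,y],z]+[y,[x,z]]$. A representation $(V,\rho^L,\rho^R)$ of it is a vector space $V$ with linear maps $\rho^L,\rho^R:\mathfrak g\to\mathfrak{gl}(V)$ such that for all $x,y\in\mathfrak g$: $\rho^L([x,y])=[\rho^L(x),\rho^L(y)]$, $\rho^R([x,y])=[\rho^L(x),\rho^R(y)]$ (commutators), and $\rho^R(y)\rho^L(x)=-\rho^R(y)\rho^R(x)$. An $\mathcal O$-operator on $\mathfrak g$ with respect to $(V,\rho^L,\rho^R)$ is a linear map $K:V\to\mathfrak g$ with $[K(u),K(v)]=K(\rho^L(K(u))v+\rho^R(K(v))u)$. Then $V_K$ denotes $V$ with the Leibniz bracket $[u,v]^K=\rho^L(K(u))v+\rho^R(K(v))u$, and $V_K$ has a representation $(\mathfrak g,\varrho_K^L,\varrho_K^R)$ given by $\varrho_K^L(v)x=[K(v),x]-K(\rho^R(x)v)$, $\varrho_K^R(v)x=[x,K(v)]-K(\rho^L(x)v)$. The twilled Leibniz algebra $\mathfrak g\bowtie V_K$ is $\mathfrak g\oplus V$ with the Leibniz bracket $\{x+u,y+v\}_K=[x,y]+\varrho_K^L(u)y+\varrho_K^R(v)x+\rho^L(x)v+\rho^R(y)u+[u,v]^K$. Strong Maurer-Cartan equation: for a vector space $E$, a bilinear map $\mu:E\times E\to E$ and a linear map $T:E\to E$, put $\{\mu,T\}^B(u,v)=\mu(T(u),v)+\mu(u,T(v))-T(\mu(u,v))$.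 On $E=\mathfrak g\oplus V$ let $\hat\mu_1(x+u,y+v)=[x,y]+\rho^L(x)v+\rho^R(y)u$ and $\hat\mu_2(x+u,y+v)=[u,v]^K+\varrho_K^L(u)y+\varrho_K^R(v)x$. For a linear map $\Theta:\mathfrak g\to V$ let $\hat\Theta(x+u)=\Theta(x)$, $d_{\hat\mu_1}\Theta=\{\hat\mu_1,\hat\Theta\}^B$, $\{\{\Theta,\Theta\}\}=-\{\{\hat\mu_2,\hat\Theta\}^B,\hat\Theta\}^B$. The strong Maurer-Cartan equation on $\mathfrak g\bowtie V_K$ is $d_{\hat\mu_1}\Theta=\frac12\{\{\Theta,\Theta\}\}=0$. Dual $\mathcal O$N-structures: for a Leibniz algebra $(\mathfrak a,[\ ,\ ])$ with representation $(W,\rho^L,\rho^R)$, a triple $(T,P,Q)$ with $T:W\to\mathfrak a$ linear, $P\in\mathfrak{gl}(W)$, $Q\in\mathfrak{gl}(\mathfrak a)$ is a dual $\mathcal O$N-structure if: $T$ is an $\mathcal O$-operator on $\mathfrak a$ with respect to $(W,\rho^L,\rho^R)$; $(Q,P)$ is a dual-Nijenhuis pair, i.e. $Q$ is a Nijenhuis operator ($[Q(x),Q(y)]=Q([Q(x),y]+[x,Q(y)]-Q[x,y])$ for $x,y\in\mathfrak a$) and for all $y\in\mathfrak a$, $w\in W$ and each $\rho\in\{\rho^L,\rho^R\}$, $\rho(Q(y))P(w)=P(\rho(Q(y))w)+\rho(y)P^2(w)-P(\rho(y)P(w))$; $QT=TP$; and for all $w,u\in W$, $\rho^L(QT(w))u+\rho^R(QT(u))w=[P(w),u]^T+[w,P(u)]^T-P[w,u]^T$,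 where $[w,u]^T=\rho^L(T(w))u+\rho^R(T(u))w$. *)

theory Defs
  imports "HOL-Analysis.Product_Vector"
begin

text \<open>
  A vector space over a field \<open>'k\<close> of characteristic 0 is an abelian group type together with
  a scalar multiplication satisfying \<^locale>\<open>vector_space\<close>; the direct sum of \<open>g\<close> and \<open>V\<close>
  is the product type, with scalar multiplication \<^const>\<open>module_prod.scale\<close> and the
  element \<open>x + u\<close> written \<open>(x, u)\<close>.
\<close>

definition fin_dim_space ::
  "('k::field_char_0 \<Rightarrow> 'a::ab_group_add \<Rightarrow> 'a) \<Rightarrow> bool" where
  "fin_dim_space s \<longleftrightarrow> (\<exists>B. finite_dimensional_vector_space s B)"

definition bilinear_map ::
  "('k::field_char_0 \<Rightarrow> 'a::ab_group_add \<Rightarrow> 'a) \<Rightarrow> ('k \<Rightarrow> 'b::ab_group_add \<Rightarrow> 'b)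
    \<Rightarrow> ('k \<Rightarrow> 'c::ab_group_add \<Rightarrow> 'c) \<Rightarrow> ('a \<Rightarrow> 'b \<Rightarrow> 'c) \<Rightarrow> bool" where
  "bilinear_map s1 s2 s3 f \<longleftrightarrow>
     (\<forall>x. Vector_Spaces.linear s2 s3 (f x)) \<and> (\<forall>y. Vector_Spaces.linear s1 s3 (\<lambda>x. f x y))"

locale leibniz_algebra =
  fixes sa :: "'k::field_char_0 \<Rightarrow> 'a::ab_group_add \<Rightarrow> 'a"
    and br :: "'a \<Rightarrow> 'a \<Rightarrow> 'a"
  assumes fin_dim_algebra: "fin_dim_space sa"
    and bilinear_bracket: "bilinear_map sa sa sa br"
    and leibniz: "br x (br y z) = br (br x y) z + br y (br x z)"

text \<open>
  A linear map from the algebra to \<open>gl(W)\<close> is encoded as a bilinear map taking an algebra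
  element and a vector of \<open>W\<close>, so the commutators below are evaluated at \<open>w\<close>.
\<close>

locale leibniz_representation = leibniz_algebra sa br
  for sa :: "'k::field_char_0 \<Rightarrow> 'a::ab_group_add \<Rightarrow> 'a"
    and br :: "'a \<Rightarrow> 'a \<Rightarrow> 'a" +
  fixes sw :: "'k \<Rightarrow> 'w::ab_group_add \<Rightarrow> 'w"
    and rhoL rhoR :: "'a \<Rightarrow> 'w \<Rightarrow> 'w"
  assumes fin_dim_rep: "fin_dim_space sw"
    and bilinear_rhoL: "bilinear_map sa sw sw rhoL"
    and bilinear_rhoR: "bilinear_map sa sw sw rhoR"
    and rhoL_bracket: "rhoL (br x y) w = rhoL x (rhoL y w) - rhoL y (rhoL x w)"
    and rhoR_bracket: "rhoR (br x y) w = rhoL x (rhoR y w) - rhoR y (rhoL x w)"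
    and rhoR_rhoL: "rhoR y (rhoL x w) = - rhoR y (rhoR x w)"

definition O_operator ::
  "('k::field_char_0 \<Rightarrow> 'a::ab_group_add \<Rightarrow> 'a) \<Rightarrow> ('a \<Rightarrow> 'a \<Rightarrow> 'a)
    \<Rightarrow> ('k \<Rightarrow> 'w::ab_group_add \<Rightarrow> 'w) \<Rightarrow> ('a \<Rightarrow> 'w \<Rightarrow> 'w) \<Rightarrow> ('a \<Rightarrow> 'w \<Rightarrow> 'w)
    \<Rightarrow> ('w \<Rightarrow> 'a) \<Rightarrow> bool" where
  "O_operator sa br sw rhoL rhoR T \<longleftrightarrow>
     Vector_Spaces.linear sw sa T \<and>
     (\<forall>u v. br (T u) (T v) = T (rhoL (T u) v + rhoR (T v) u))"

text \<open>The bracket \<open>[u, v]\<close> on \<open>W\<close> induced by \<open>T\<close>, and the two action maps of that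
  algebra on \<open>a\<close>.\<close>

definition induced_bracket ::
  "('a \<Rightarrow> 'w \<Rightarrow> 'w) \<Rightarrow> ('a \<Rightarrow> 'w \<Rightarrow> 'w) \<Rightarrow> ('w \<Rightarrow> 'a) \<Rightarrow> 'w \<Rightarrow> 'w \<Rightarrow> 'w::ab_group_add" where
  "induced_bracket rhoL rhoR T u v = rhoL (T u) v + rhoR (T v) u"

definition induced_left ::
  "('a \<Rightarrow> 'a \<Rightarrow> 'a) \<Rightarrow> ('a \<Rightarrow> 'w \<Rightarrow> 'w) \<Rightarrow> ('w \<Rightarrow> 'a) \<Rightarrow> 'w \<Rightarrow> 'a \<Rightarrow> 'a::ab_group_add" where
  "induced_left br rhoR T v x = br (T v) x - T (rhoR x v)"

definition induced_right ::
  "('a \<Rightarrow> 'a \<Rightarrow> 'a) \<Rightarrow> ('a \<Rightarrow> 'w \<Rightarrow> 'w) \<Rightarrow> ('w \<Rightarrow> 'a) \<Rightarrow> 'w \<Rightarrow> 'a \<Rightarrow> 'a::ab_group_add" where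
  "induced_right br rhoL T v x = br x (T v) - T (rhoL x v)"

definition mu1_hat ::
  "('a::ab_group_add \<Rightarrow> 'a \<Rightarrow> 'a) \<Rightarrow> ('a \<Rightarrow> 'w \<Rightarrow> 'w) \<Rightarrow> ('a \<Rightarrow> 'w \<Rightarrow> 'w)
    \<Rightarrow> 'a \<times> 'w \<Rightarrow> 'a \<times> 'w \<Rightarrow> 'a \<times> 'w::ab_group_add" where
  "mu1_hat br rhoL rhoR = (\<lambda>(x, u) (y, v). (br x y, rhoL x v + rhoR y u))"

definition mu2_hat ::
  "('a::ab_group_add \<Rightarrow> 'a \<Rightarrow> 'a) \<Rightarrow> ('a \<Rightarrow> 'w \<Rightarrow> 'w) \<Rightarrow> ('a \<Rightarrow> 'w \<Rightarrow> 'w) \<Rightarrow> ('w \<Rightarrow> 'a)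
    \<Rightarrow> 'a \<times> 'w \<Rightarrow> 'a \<times> 'w \<Rightarrow> 'a \<times> 'w::ab_group_add" where
  "mu2_hat br rhoL rhoR K = (\<lambda>(x, u) (y, v).
     (induced_left br rhoR K u y + induced_right br rhoL K v x, induced_bracket rhoL rhoR K u v))"

definition twilled_bracket ::
  "('a::ab_group_add \<Rightarrow> 'a \<Rightarrow> 'a) \<Rightarrow> ('a \<Rightarrow> 'w \<Rightarrow> 'w) \<Rightarrow> ('a \<Rightarrow> 'w \<Rightarrow> 'w) \<Rightarrow> ('w \<Rightarrow> 'a)
    \<Rightarrow> 'a \<times> 'w \<Rightarrow> 'a \<times> 'w \<Rightarrow> 'a \<times> 'w::ab_group_add" where
  "twilled_bracket br rhoL rhoR K = (\<lambda>(x, u) (y, v).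
     (br x y + induced_left br rhoR K u y + induced_right br rhoL K v x,
      rhoL x v + rhoR y u + induced_bracket rhoL rhoR K u v))"

lemma twilled_bracket_eq:
  "twilled_bracket br rhoL rhoR K p q = mu1_hat br rhoL rhoR p q + mu2_hat br rhoL rhoR K p q"
  by (simp add: twilled_bracket_def mu1_hat_def mu2_hat_def split_beta add.assoc)

text \<open>The operation \<open>{\<mu>, T}\<close> (with superscript \<open>B\<close>).\<close>

definition brace_B ::
  "('e \<Rightarrow> 'e \<Rightarrow> 'e) \<Rightarrow> ('e \<Rightarrow> 'e) \<Rightarrow> 'e \<Rightarrow> 'e \<Rightarrow> 'e::ab_group_add" where
  "brace_B \<mu> T u v = \<mu> (T u) v + \<mu> u (T v) - T (\<mu> u v)"

definition hat_map :: "('a::ab_group_add \<Rightarrow> 'w::ab_group_add) \<Rightarrow> 'a \<times> 'w \<Rightarrow> 'a \<times> 'w" where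
  "hat_map \<Theta> = (\<lambda>(x, u). (0, \<Theta> x))"

definition d_mu1 ::
  "('a::ab_group_add \<Rightarrow> 'a \<Rightarrow> 'a) \<Rightarrow> ('a \<Rightarrow> 'w \<Rightarrow> 'w) \<Rightarrow> ('a \<Rightarrow> 'w \<Rightarrow> 'w) \<Rightarrow> ('a \<Rightarrow> 'w)
    \<Rightarrow> 'a \<times> 'w \<Rightarrow> 'a \<times> 'w \<Rightarrow> 'a \<times> 'w::ab_group_add" where
  "d_mu1 br rhoL rhoR \<Theta> = brace_B (mu1_hat br rhoL rhoR) (hat_map \<Theta>)"

definition double_brace ::
  "('a::ab_group_add \<Rightarrow> 'a \<Rightarrow> 'a) \<Rightarrow> ('a \<Rightarrow> 'w \<Rightarrow> 'w) \<Rightarrow> ('a \<Rightarrow> 'w \<Rightarrow> 'w) \<Rightarrow> ('w \<Rightarrow> 'a)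
    \<Rightarrow> ('a \<Rightarrow> 'w) \<Rightarrow> 'a \<times> 'w \<Rightarrow> 'a \<times> 'w \<Rightarrow> 'a \<times> 'w::ab_group_add" where
  "double_brace br rhoL rhoR K \<Theta> p q =
     - brace_B (brace_B (mu2_hat br rhoL rhoR K) (hat_map \<Theta>)) (hat_map \<Theta>) p q"

definition strong_Maurer_Cartan ::
  "('k::field_char_0 \<Rightarrow> 'a::ab_group_add \<Rightarrow> 'a) \<Rightarrow> ('a \<Rightarrow> 'a \<Rightarrow> 'a)
    \<Rightarrow> ('k \<Rightarrow> 'w::ab_group_add \<Rightarrow> 'w) \<Rightarrow> ('a \<Rightarrow> 'w \<Rightarrow> 'w) \<Rightarrow> ('a \<Rightarrow> 'w \<Rightarrow> 'w)
    \<Rightarrow> ('w \<Rightarrow> 'a) \<Rightarrow> ('a \<Rightarrow> 'w) \<Rightarrow> bool" where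
  "strong_Maurer_Cartan sa br sw rhoL rhoR K \<Theta> \<longleftrightarrow>
     (\<forall>p q. d_mu1 br rhoL rhoR \<Theta> p q
              = module_prod.scale sa sw (1 / 2) (double_brace br rhoL rhoR K \<Theta> p q) \<and>
            module_prod.scale sa sw (1 / 2) (double_brace br rhoL rhoR K \<Theta> p q) = 0)"

definition Nijenhuis_operator ::
  "('k::field_char_0 \<Rightarrow> 'a::ab_group_add \<Rightarrow> 'a) \<Rightarrow> ('a \<Rightarrow> 'a \<Rightarrow> 'a) \<Rightarrow> ('a \<Rightarrow> 'a) \<Rightarrow> bool" where
  "Nijenhuis_operator sa br Q \<longleftrightarrow>
     Vector_Spaces.linear sa sa Q \<and>
     (\<forall>x y. br (Q x) (Q y) = Q (br (Q x) y + br x (Q y) - Q (br x y)))"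

definition dual_Nijenhuis_pair ::
  "('k::field_char_0 \<Rightarrow> 'a::ab_group_add \<Rightarrow> 'a) \<Rightarrow> ('a \<Rightarrow> 'a \<Rightarrow> 'a)
    \<Rightarrow> ('k \<Rightarrow> 'w::ab_group_add \<Rightarrow> 'w) \<Rightarrow> ('a \<Rightarrow> 'w \<Rightarrow> 'w) \<Rightarrow> ('a \<Rightarrow> 'w \<Rightarrow> 'w)
    \<Rightarrow> ('a \<Rightarrow> 'a) \<Rightarrow> ('w \<Rightarrow> 'w) \<Rightarrow> bool" where
  "dual_Nijenhuis_pair sa br sw rhoL rhoR Q P \<longleftrightarrow>
     Nijenhuis_operator sa br Q \<and> Vector_Spaces.linear sw sw P \<and>
     (\<forall>\<rho>\<in>{rhoL, rhoR}. \<forall>y w.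
        \<rho> (Q y) (P w) = P (\<rho> (Q y) w) + \<rho> y (P (P w)) - P (\<rho> y (P w)))"

text \<open>Being a dual ON-structure includes that the underlying data form a Leibniz algebra
  with a representation.\<close>

definition dual_ON_structure ::
  "('k::field_char_0 \<Rightarrow> 'a::ab_group_add \<Rightarrow> 'a) \<Rightarrow> ('a \<Rightarrow> 'a \<Rightarrow> 'a)
    \<Rightarrow> ('k \<Rightarrow> 'w::ab_group_add \<Rightarrow> 'w) \<Rightarrow> ('a \<Rightarrow> 'w \<Rightarrow> 'w) \<Rightarrow> ('a \<Rightarrow> 'w \<Rightarrow> 'w)
    \<Rightarrow> ('w \<Rightarrow> 'a) \<Rightarrow> ('w \<Rightarrow> 'w) \<Rightarrow> ('a \<Rightarrow> 'a) \<Rightarrow> bool" where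
  "dual_ON_structure sa br sw rhoL rhoR T P Q \<longleftrightarrow>
     leibniz_representation sa br sw rhoL rhoR \<and>
     O_operator sa br sw rhoL rhoR T \<and>
     dual_Nijenhuis_pair sa br sw rhoL rhoR Q P \<and>
     Q \<circ> T = T \<circ> P \<and>
     (\<forall>w u. rhoL (Q (T w)) u + rhoR (Q (T u)) w =
        induced_bracket rhoL rhoR T (P w) u + induced_bracket rhoL rhoR T w (P u)
          - P (induced_bracket rhoL rhoR T w u))"

end

theory Submission
  imports Defs
begin

text \<open>
  Call a linear map \<open>D\<close> from a Leibniz algebra \<open>a\<close> to a representation \<open>W\<close> a derivation if
  \<open>D [x, y] = \<rho>\<^sup>L(x) D y + \<rho>\<^sup>R(y) D x\<close>. Both halves of the theorem are instances of one fact: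
  if \<open>T : W \<rightarrow> a\<close> is an \<open>O\<close>-operator, and both \<open>D\<close> and \<open>D T D\<close> are derivations, then
  \<open>(T, D T, T D)\<close> is a dual \<open>O\<close>N-structure (\<open>dual_ON_structure_of_derivations\<close>).

  The two equations in the strong Maurer-Cartan condition say that \<open>\<Theta>\<close> is a derivation
  \<open>g \<rightarrow> V\<close> and that \<open>\<Theta>\<close> is an \<open>O\<close>-operator on \<open>V\<^sub>K\<close> with respect to the induced representation on
  \<open>g\<close>. Given the first, the second amounts to \<open>\<Theta> K \<Theta>\<close> being a derivation
  (\<open>derivation_sandwich\<close>), so the general fact applies to \<open>K\<close> and \<open>\<Theta>\<close> on \<open>g\<close> and
  yields (i).

  For (ii) the roles are exchanged: the \<open>O\<close>-operator is now \<open>\<Theta>\<close>, and the derivation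
  is \<open>K : V\<^sub>K \<rightarrow> g\<close>. That \<open>K\<close> and \<open>K \<Theta> K\<close> are derivations follows from \<open>K\<close> being an
  \<open>O\<close>-operator together with \<open>\<Theta>\<close> being a derivation
  (\<open>O_operator_is_derivation\<close>, \<open>derivation_sandwich_induced\<close>). What remains is that
  \<open>V\<^sub>K\<close> is a Leibniz algebra with representation \<open>g\<close>
  (\<open>leibniz_representation_induced\<close>), which is a direct expansion.
\<close>

section \<open>Derivations and linearity\<close>

definition derivation_on ::
  "('a \<Rightarrow> 'a \<Rightarrow> 'a) \<Rightarrow> ('a \<Rightarrow> 'w \<Rightarrow> 'w) \<Rightarrow> ('a \<Rightarrow> 'w \<Rightarrow> 'w) \<Rightarrow> ('a \<Rightarrow> 'w::ab_group_add) \<Rightarrow> bool" where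
  "derivation_on br rhoL rhoR D \<longleftrightarrow> (\<forall>x y. D (br x y) = rhoL x (D y) + rhoR y (D x))"

lemma derivation_onD:
  "derivation_on br rhoL rhoR D \<Longrightarrow> D (br x y) = rhoL x (D y) + rhoR y (D x)"
  by (simp add: derivation_on_def)

lemma linear_simps:
  assumes "Vector_Spaces.linear s1 s2 f"
  shows "f (x + y) = f x + f y" "f (x - y) = f x - f y" "f (- x) = - f x" "f 0 = 0"
    "f (s1 c x) = s2 c (f x)"
proof -
  interpret Vector_Spaces.linear s1 s2 f by (fact assms)
  show "f (x + y) = f x + f y" "f (x - y) = f x - f y" "f (- x) = - f x" "f 0 = 0"
    "f (s1 c x) = s2 c (f x)"
    by (simp_all add: add diff neg scale)
qed

lemma bilinear_map_simps:
  assumes "bilinear_map s1 s2 s3 f"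
  shows "f (x + x') y = f x y + f x' y" "f (x - x') y = f x y - f x' y"
    "f (- x) y = - f x y" "f 0 y = 0" "f (s1 c x) y = s3 c (f x y)"
    "f x (y + y') = f x y + f x y'" "f x (y - y') = f x y - f x y'"
    "f x (- y) = - f x y" "f x 0 = 0" "f x (s2 c y) = s3 c (f x y)"
proof -
  have 1: "Vector_Spaces.linear s1 s3 (\<lambda>x. f x y)" and 2: "Vector_Spaces.linear s2 s3 (f x)"
    for x y using assms by (simp_all add: bilinear_map_def)
  show "f (x + x') y = f x y + f x' y" "f (x - x') y = f x y - f x' y"
    "f (- x) y = - f x y" "f 0 y = 0" "f (s1 c x) y = s3 c (f x y)"
    using linear_simps[OF 1] by auto
  show "f x (y + y') = f x y + f x y'" "f x (y - y') = f x y - f x y'"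
    "f x (- y) = - f x y" "f x 0 = 0" "f x (s2 c y) = s3 c (f x y)"
    using linear_simps[OF 2] by auto
qed

context leibniz_representation
begin

lemmas br_simps = bilinear_map_simps[OF bilinear_bracket]
lemmas rhoL_simps = bilinear_map_simps[OF bilinear_rhoL]
lemmas rhoR_simps = bilinear_map_simps[OF bilinear_rhoR]

lemma vector_space_sa: "vector_space sa"
  using bilinear_rhoL by (auto simp: bilinear_map_def Vector_Spaces.linear_iff)

lemma vector_space_sw: "vector_space sw"
  using bilinear_rhoL by (auto simp: bilinear_map_def Vector_Spaces.linear_iff)

lemmas scale_simps =
  module.scale_right_distrib[OF vector_space_sa[unfolded module_iff_vector_space[symmetric]]]
  module.scale_right_diff_distrib[OF vector_space_sa[unfolded module_iff_vector_space[symmetric]]]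
  module.scale_right_distrib[OF vector_space_sw[unfolded module_iff_vector_space[symmetric]]]

text \<open>The Leibniz identity makes left multiplication by \<open>[x, y]\<close> the commutator of two left
  multiplications. Hence swapping \<open>x\<close> and \<open>y\<close> changes its sign, even where \<open>[y, x] \<noteq> - [x, y]\<close>.\<close>

lemma br_swap: "br (br y x) z = - br (br x y) z"
  using leibniz[of x y z] leibniz[of y x z] by (simp add: eq_neg_iff_add_eq_0 algebra_simps)

section \<open>Dual \<open>O\<close>N-structures from derivations\<close>

text \<open>Put \<open>Q = T D\<close> and \<open>P = D T\<close>, so that \<open>D Q = P D\<close>. In
  \<open>D ([Q x, y] + [x, Q y] - Q [x, y])\<close> the derivation rule for \<open>D T D\<close> cancels the terms
  \<open>\<rho>\<^sup>R(y) D Q x\<close> and \<open>\<rho>\<^sup>L(x) D Q y\<close>; applying \<open>T\<close> to the rest gives \<open>[Q x, Q y]\<close>, which is the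
  Nijenhuis identity. The remaining identities compare the derivation rules for \<open>D\<close> and
  \<open>D T D\<close> at arguments in the image of \<open>T\<close>, where the bracket is the \<open>T\<close>-image of the induced
  one.\<close>

lemma dual_ON_structure_of_derivations:
  assumes T: "O_operator sa br sw rhoL rhoR T"
    and linD: "Vector_Spaces.linear sa sw D"
    and D: "derivation_on br rhoL rhoR D"
    and DTD: "derivation_on br rhoL rhoR (D \<circ> T \<circ> D)"
  shows "dual_ON_structure sa br sw rhoL rhoR T (D \<circ> T) (T \<circ> D)"
proof -
  have linT: "Vector_Spaces.linear sw sa T"
    and T': "br (T u) (T v) = T (rhoL (T u) v + rhoR (T v) u)" for u v
    using T by (auto simp: O_operator_def)
  note D' = derivation_onD[OF D]
  have DTD': "D (T (D (br x y))) = rhoL x (D (T (D y))) + rhoR y (D (T (D x)))" for x y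
    using derivation_onD[OF DTD] by simp
  have DT: "D (T (rhoL (T u) v + rhoR (T v) u)) = rhoL (T u) (D (T v)) + rhoR (T v) (D (T u))" for u v
    unfolding T'[symmetric] by (rule D')
  note lins = linear_simps[OF linT] linear_simps[OF linD]
  have nij: "br (T (D x)) (T (D y)) =
      T (D (br (T (D x)) y + br x (T (D y)) - T (D (br x y))))" for x y
  proof -
    have "D (br (T (D x)) y + br x (T (D y)) - T (D (br x y)))
        = rhoL (T (D x)) (D y) + rhoR (T (D y)) (D x)"
      by (simp only: linear_simps[OF linD] DTD') (simp add: D')
    then show ?thesis by (simp only: T')
  qed
  \<comment> \<open>Both differences measure how far \<open>D T\<close> is from commuting with the opposite action of \<open>T w\<close>.\<close>
  have left: "rhoL (T (D y)) (D (T w)) =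
      D (T (rhoL (T (D y)) w)) + rhoL y (D (T (D (T w)))) - D (T (rhoL y (D (T w))))" for y w
  proof -
    have 1: "rhoL y (D (T (D (T w)))) - D (T (rhoL y (D (T w)))) =
        D (T (rhoR (T w) (D y))) - rhoR (T w) (D (T (D y)))"
      using DTD'[of y "T w"] by (simp add: D' lins algebra_simps)
    have 2: "rhoL (T (D y)) (D (T w)) - D (T (rhoL (T (D y)) w)) =
        D (T (rhoR (T w) (D y))) - rhoR (T w) (D (T (D y)))"
      using DT[of "D y" w] by (simp add: lins algebra_simps)
    show ?thesis using 2[folded 1] by (simp add: algebra_simps)
  qed
  have right: "rhoR (T (D y)) (D (T w)) =
      D (T (rhoR (T (D y)) w)) + rhoR y (D (T (D (T w)))) - D (T (rhoR y (D (T w))))" for y w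
  proof -
    have 1: "rhoR y (D (T (D (T w)))) - D (T (rhoR y (D (T w)))) =
        D (T (rhoL (T w) (D y))) - rhoL (T w) (D (T (D y)))"
      using DTD'[of "T w" y] by (simp add: D' lins algebra_simps)
    have 2: "rhoR (T (D y)) (D (T w)) - D (T (rhoR (T (D y)) w)) =
        D (T (rhoL (T w) (D y))) - rhoL (T w) (D (T (D y)))"
      using DT[of w "D y"] by (simp add: lins algebra_simps)
    show ?thesis using 2[folded 1] by (simp add: algebra_simps)
  qed
  have linTD: "Vector_Spaces.linear sa sa (T \<circ> D)" and linDT: "Vector_Spaces.linear sw sw (D \<circ> T)"
    using linT linD by (auto intro: Vector_Spaces.linear_compose)
  have "dual_Nijenhuis_pair sa br sw rhoL rhoR (T \<circ> D) (D \<circ> T)"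
    using linTD linDT nij left right
    by (auto simp: dual_Nijenhuis_pair_def Nijenhuis_operator_def)
  moreover have "rhoL ((T \<circ> D) (T w)) u + rhoR ((T \<circ> D) (T u)) w =
        induced_bracket rhoL rhoR T ((D \<circ> T) w) u + induced_bracket rhoL rhoR T w ((D \<circ> T) u)
          - (D \<circ> T) (induced_bracket rhoL rhoR T w u)" for u w
    using DT[of w u] by (simp add: induced_bracket_def)
  ultimately show ?thesis
    using T leibniz_representation_axioms by (simp add: dual_ON_structure_def comp_assoc)
qed

section \<open>The representation induced by an \<open>O\<close>-operator\<close>

text \<open>The \<open>O\<close>-operator equation lets brackets of values of \<open>T\<close> be traded for values of \<open>T\<close>,
  and then each identity reduces to the Leibniz identity and the representation axioms with
  some of the algebra elements replaced by \<open>T u\<close> and \<open>T v\<close>.\<close>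

lemma leibniz_representation_induced:
  assumes T: "O_operator sa br sw rhoL rhoR T"
  shows "leibniz_representation sw (induced_bracket rhoL rhoR T) sa
           (induced_left br rhoR T) (induced_right br rhoL T)"
proof -
  have linT: "Vector_Spaces.linear sw sa T"
    and T': "br (T u) (T v) = T (rhoL (T u) v + rhoR (T v) u)" for u v
    using T by (auto simp: O_operator_def)
  note defs = induced_bracket_def induced_left_def induced_right_def
  note lins = linear_simps[OF linT] br_simps rhoL_simps rhoR_simps scale_simps
  have T_bracket: "T (induced_bracket rhoL rhoR T u v) = br (T u) (T v)" for u v
    by (simp add: induced_bracket_def T')
  have bil_br: "bilinear_map sw sw sw (induced_bracket rhoL rhoR T)"
    and bil_left: "bilinear_map sw sa sa (induced_left br rhoR T)"
    and bil_right: "bilinear_map sw sa sa (induced_right br rhoL T)"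
    using vector_space_sa vector_space_sw
    by (simp_all add: bilinear_map_def Vector_Spaces.linear_iff defs lins)
  show ?thesis
  proof (unfold_locales, fact fin_dim_rep, fact bil_br, goal_cases)
    case (1 u v w)
    show ?case
      by (simp add: induced_bracket_def T'[symmetric] rhoL_simps rhoR_simps
          rhoL_bracket rhoR_bracket rhoR_rhoL algebra_simps)
  next
    case 2 show ?case by (fact fin_dim_algebra)
  next
    case 3 show ?case by (fact bil_left)
  next
    case 4 show ?case by (fact bil_right)
  next
    case (5 u v x)
    show ?case
      using leibniz[of "T u" "T v" x] unfolding induced_left_def T_bracket
      by (simp add: induced_bracket_def T' rhoR_bracket rhoR_rhoL lins algebra_simps)
  next
    case (6 u v x)
    show ?case
      using leibniz[of "T u" x "T v"] unfolding induced_left_def induced_right_def T_bracket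
      by (simp add: induced_bracket_def T' rhoL_bracket rhoR_bracket rhoR_rhoL lins algebra_simps)
  next
    case (7 v u x)
    show ?case
      using br_swap[of x "T u" "T v"] unfolding induced_left_def induced_right_def
      by (simp add: T' rhoL_bracket rhoR_bracket rhoR_rhoL lins algebra_simps)
  qed
qed

text \<open>The two correction terms \<open>T(\<rho>\<^sup>R \<dots>)\<close> and \<open>T(\<rho>\<^sup>L \<dots>)\<close> of the induced actions add up to one
  copy of \<open>[T u, T v]\<close>, which leaves one of the two copies in the Leibniz rule.\<close>

lemma O_operator_is_derivation:
  assumes T: "O_operator sa br sw rhoL rhoR T"
  shows "derivation_on (induced_bracket rhoL rhoR T)
           (induced_left br rhoR T) (induced_right br rhoL T) T"
proof -
  have linT: "Vector_Spaces.linear sw sa T"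
    and T': "br (T u) (T v) = T (rhoL (T u) v + rhoR (T v) u)" for u v
    using T by (auto simp: O_operator_def)
  show ?thesis
    by (simp add: derivation_on_def induced_bracket_def induced_left_def induced_right_def T'
        linear_simps[OF linT])
qed

text \<open>In the \<open>O\<close>-operator equation for \<open>D\<close>, the derivation rule expands \<open>D [T D x, y]\<close> and
  \<open>D [x, T D y]\<close>. The terms in which \<open>T D x\<close> or \<open>T D y\<close> acts on \<open>W\<close> cancel, and what is left is
  the derivation rule for \<open>D T D\<close>.\<close>

lemma derivation_sandwich:
  assumes linT: "Vector_Spaces.linear sw sa T"
    and D: "derivation_on br rhoL rhoR D"
    and OD: "O_operator sw (induced_bracket rhoL rhoR T) sa
           (induced_left br rhoR T) (induced_right br rhoL T) D"
  shows "derivation_on br rhoL rhoR (D \<circ> T \<circ> D)"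
proof -
  have linD: "Vector_Spaces.linear sa sw D" using OD by (simp add: O_operator_def)
  note D' = derivation_onD[OF D]
  note lins = linear_simps[OF linT] linear_simps[OF linD]
  show ?thesis unfolding derivation_on_def
  proof (intro allI)
    fix x y
    have "rhoL (T (D x)) (D y) + rhoR (T (D y)) (D x) =
        D (br (T (D x)) y - T (rhoR y (D x)) + (br x (T (D y)) - T (rhoL x (D y))))"
      using OD by (simp add: O_operator_def induced_bracket_def induced_left_def induced_right_def)
    then show "(D \<circ> T \<circ> D) (br x y) = rhoL x ((D \<circ> T \<circ> D) y) + rhoR y ((D \<circ> T \<circ> D) x)"
      by (simp add: lins D' algebra_simps)
  qed
qed

text \<open>The value \<open>T D [T u, T v]\<close> arises on both sides of the derivation rule for \<open>T D T\<close>: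
  on the left since \<open>T\<close> carries the induced bracket to the bracket of \<open>a\<close>, and on the right
  after the \<open>O\<close>-operator equation is applied to \<open>[T u, T D T v]\<close> and \<open>[T D T u, T v]\<close>.\<close>

lemma derivation_sandwich_induced:
  assumes T: "O_operator sa br sw rhoL rhoR T"
    and D: "derivation_on br rhoL rhoR D"
  shows "derivation_on (induced_bracket rhoL rhoR T)
           (induced_left br rhoR T) (induced_right br rhoL T) (T \<circ> D \<circ> T)"
proof -
  have linT: "Vector_Spaces.linear sw sa T"
    and T': "br (T u) (T v) = T (rhoL (T u) v + rhoR (T v) u)" for u v
    using T by (auto simp: O_operator_def)
  have DT: "D (T (rhoL (T u) v + rhoR (T v) u)) = rhoL (T u) (D (T v)) + rhoR (T v) (D (T u))" for u v
    unfolding T'[symmetric] by (rule derivation_onD[OF D])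
  show ?thesis
    unfolding derivation_on_def
    by (simp add: induced_bracket_def induced_left_def induced_right_def DT T')
      (simp add: linear_simps[OF linT])
qed

section \<open>The strong Maurer-Cartan equation\<close>

lemma strong_Maurer_Cartan_derivation:
  assumes linD: "Vector_Spaces.linear sa sw D"
    and MC: "strong_Maurer_Cartan sa br sw rhoL rhoR T D"
  shows "derivation_on br rhoL rhoR D"
  unfolding derivation_on_def
proof (intro allI)
  fix x y
  have "d_mu1 br rhoL rhoR D (x, 0) (y, 0) = 0"
    using MC by (simp add: strong_Maurer_Cartan_def)
  then show "D (br x y) = rhoL x (D y) + rhoR y (D x)"
    by (simp add: d_mu1_def brace_B_def mu1_hat_def hat_map_def zero_prod_def br_simps rhoL_simps
        rhoR_simps linear_simps[OF linD] algebra_simps)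
qed

text \<open>Since \<open>D\<close> lifts to a square-zero map of \<open>a \<oplus> W\<close>, the iterated brace collapses to twice
  \<open>[D x, D y]\<^sup>T - D (\<rho>\<^sup>L\<^sub>T(D x) y + \<rho>\<^sup>R\<^sub>T(D y) x)\<close>, and characteristic 0 removes the factor 2.\<close>

lemma strong_Maurer_Cartan_O_operator:
  assumes linT: "Vector_Spaces.linear sw sa T"
    and linD: "Vector_Spaces.linear sa sw D"
    and MC: "strong_Maurer_Cartan sa br sw rhoL rhoR T D"
  shows "O_operator sw (induced_bracket rhoL rhoR T) sa
           (induced_left br rhoR T) (induced_right br rhoL T) D"
proof -
  note lins = linear_simps[OF linT] linear_simps[OF linD] br_simps rhoL_simps rhoR_simps
  interpret W: vector_space sw by (fact vector_space_sw)
  interpret P: module_prod sa sw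
    using vector_space_sa vector_space_sw by (simp add: module_prod_def module_pair_def module_iff_vector_space)
  have "induced_bracket rhoL rhoR T (D x) (D y)
      = D (induced_left br rhoR T (D x) y + induced_right br rhoL T (D y) x)" for x y
  proof -
    define d where "d = induced_bracket rhoL rhoR T (D x) (D y)
      - D (induced_left br rhoR T (D x) y + induced_right br rhoL T (D y) x)"
    have "double_brace br rhoL rhoR T D (x, 0) (y, 0) = (0, - (d + d))"
      by (simp add: d_def double_brace_def brace_B_def mu2_hat_def hat_map_def induced_bracket_def
          induced_left_def induced_right_def lins algebra_simps)
    moreover have "P.scale (1 / 2) (double_brace br rhoL rhoR T D (x, 0) (y, 0)) = 0"
      using MC by (simp add: strong_Maurer_Cartan_def)
    ultimately have "sw (1 / 2) (- (d + d)) = 0"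
      by (simp only: P.scale_def zero_prod_def fst_conv snd_conv prod.inject)
    moreover have "d + d = sw 2 d"
      using W.scale_left_distrib[of 1 1 d] by simp
    ultimately have "d = 0" by simp
    then show ?thesis by (simp add: d_def)
  qed
  then show ?thesis using linD by (simp add: O_operator_def induced_bracket_def)
qed

end

theorem theorem5p4:
  fixes sg :: "'k::field_char_0 \<Rightarrow> 'g::ab_group_add \<Rightarrow> 'g"
    and sV :: "'k \<Rightarrow> 'v::ab_group_add \<Rightarrow> 'v"
    and br :: "'g \<Rightarrow> 'g \<Rightarrow> 'g"
    and rhoL rhoR :: "'g \<Rightarrow> 'v \<Rightarrow> 'v"
    and K :: "'v \<Rightarrow> 'g"
    and \<Theta> :: "'g \<Rightarrow> 'v"
    and N :: "'g \<Rightarrow> 'g"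
    and S :: "'v \<Rightarrow> 'v"
  assumes "leibniz_representation sg br sV rhoL rhoR"
    and "O_operator sg br sV rhoL rhoR K"
    and "Vector_Spaces.linear sg sV \<Theta>"
    and "strong_Maurer_Cartan sg br sV rhoL rhoR K \<Theta>"
    and "N = K \<circ> \<Theta>"
    and "S = \<Theta> \<circ> K"
  shows "dual_ON_structure sg br sV rhoL rhoR K S N \<and>
         dual_ON_structure sV (induced_bracket rhoL rhoR K) sg
           (induced_left br rhoR K) (induced_right br rhoL K) \<Theta> N S"
proof -
  interpret leibniz_representation sg br sV rhoL rhoR by (fact assms(1))
  interpret VK: leibniz_representation sV "induced_bracket rhoL rhoR K" sg
      "induced_left br rhoR K" "induced_right br rhoL K"
    by (rule leibniz_representation_induced) (fact assms(2))
  have linK: "Vector_Spaces.linear sV sg K" using assms(2) by (simp add: O_operator_def)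
  have der: "derivation_on br rhoL rhoR \<Theta>"
    by (rule strong_Maurer_Cartan_derivation) (fact assms(3,4))+
  have op: "O_operator sV (induced_bracket rhoL rhoR K) sg
      (induced_left br rhoR K) (induced_right br rhoL K) \<Theta>"
    by (rule strong_Maurer_Cartan_O_operator) (fact linK assms(3,4))+
  show ?thesis unfolding assms(5,6)
    using dual_ON_structure_of_derivations[OF assms(2,3) der derivation_sandwich[OF linK der op]]
      VK.dual_ON_structure_of_derivations[OF op linK O_operator_is_derivation[OF assms(2)]
        derivation_sandwich_induced[OF assms(2) der]]
    by blast
qed

end
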